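(* For each $n\ge2$ let $G_n$ be a connected weighted graph on $n$ nodes with weighted Laplacian $L_n$ and Moore–Penrose pseudoinverse $L_n^+$, let $\mu_n\in\mathbb{R}^n$ satisfy $\mathbf 1^T\mu_n=0$, and let $\omega_n$ be a random vector in $\mathbb{R}^n$ with mean zero, finite second moments, covariance matrix $\Sigma_n$, and $\sigma_n^2:=\mathbf 1^T\Sigma_n\mathbf 1>0$. For $1\le k\le n$ let $\mathcal H_k=\mathcal H_k^{(n)}$ be the average expected loss due to fluctuations with $k$ equally sharing controllable loads in this network (see context). Assume that the limit $$\gamma:=\lim_{n\to\infty}\frac{(n-1)\operatorname{tr}(\Sigma_nL_n^+)}{\sigma_n^2\,\operatorname{tr}(L_n^+)}\in[0,\infty)$$ exists. Then for every fixed integer $k\ge1$, $$\lim_{n\to\infty}\frac{\mathcal H_k^{(n)}}{\mathcal H_1^{(n)}}=\frac1{1+\gamma^{-1}}+\frac1{1+\gamma}\cdot\frac1k ,$$ where $\frac{1}{1+\gamma^{-1}}$ is read as $0$ if $\gamma=0$. In particular, if for every $n$ the load fluctuations (the components of $\omega_n$) are independent and identically distributed, then, regardless of the graphs $G_n$, $\gamma=1$ and $$\lim_{n\to\infty}\frac{\mathcal H_k^{(n)}}{\mathcal H_1^{(n)}}=\frac12+\frac1{2k}.$$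
   Context: Weighted graph: simple undirected graph on $V=\{1,\dots,n\}$ with symmetric edge weights $\beta_{i,j}=\beta_{j,i}\ge 0$ ($i\ne j$); a missing edge is the same as an edge of weight $0$, and connectedness refers to the edges of positive weight. The weighted Laplacian is $L_{i,i}=\sum_{j\ne i}\beta_{i,j}$, $L_{i,j}=-\beta_{i,j}$ for $i\neq j$. Its Moore–Penrose pseudoinverse is $L^+=(L+\frac1n\mathbf 1\mathbf 1^T)^{-1}-\frac1n\mathbf 1\mathbf 1^T$. $\mathbf 1$ denotes the all-ones vector in $\mathbb{R}^n$. For a network with data $(L,\mu,\omega)$ and $\alpha\in\mathbb{R}^n$ put $C_\alpha:=I-\alpha\mathbf 1^T$, $p(\alpha):=C_\alpha(\mu+\omega)=\mu+C_\alpha\omega$, $\mathcal H(\alpha):=\frac12p(\alpha)^TL^+p(\alpha)$ (total loss), and $\mathcal H_s(\alpha):=\mathcal H(\alpha)-\frac12\mu^TL^+\mu$ (total loss due to fluctuations). The covariance matrix is $\Sigma_{i,j}=\mathbb{E}[\omega_i\omega_j]$. For $1\le k\le n$, $$\mathcal B_k:=\Big\{\tfrac1k\sum_{i\in B}\mathbf e_i : B\subseteq V,\ |B|=k\Big\},\qquad \mathcal H_k:=\frac1{|\mathcal B_k|}\sum_{\alpha\in\mathcal B_k}\mathbb{E}\,\mathcal H_s(\alpha),$$ where $\mathbf e_i$ is the $i$-th standard basis vector of $\mathbb{R}^n$. *)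

theory Defs
  imports "HOL-Probability.Probability" "Jordan_Normal_Form.Determinant"
begin

unbundle no vec_syntax
unbundle no inner_syntax
hide_const (open) Finite_Cartesian_Product.vec Finite_Cartesian_Product.mat
  Finite_Cartesian_Product.row Finite_Cartesian_Product.rows
  Determinants.det Cartesian_Space.vector
hide_type (open) Finite_Cartesian_Product.vec

section \<open>Weighted graphs\<close>

text \<open>
  A weighted graph on the nodes \<open>0, \<dots>, n - 1\<close> is given by its weights \<open>\<beta> i j\<close> for distinct
  \<open>i, j < n\<close>; all other values of \<open>\<beta>\<close> are ignored. Weight \<open>0\<close> means that the edge is missing.
\<close>

definition weighted_graph :: "nat \<Rightarrow> (nat \<Rightarrow> nat \<Rightarrow> real) \<Rightarrow> bool" where
  "weighted_graph n \<beta> \<longleftrightarrow> (\<forall>i<n. \<forall>j<n. i \<noteq> j \<longrightarrow> \<beta> i j = \<beta> j i \<and> 0 \<le> \<beta> i j)"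

definition pos_edges :: "nat \<Rightarrow> (nat \<Rightarrow> nat \<Rightarrow> real) \<Rightarrow> (nat \<times> nat) set" where
  "pos_edges n \<beta> = {(i, j). i < n \<and> j < n \<and> i \<noteq> j \<and> 0 < \<beta> i j}"

definition connected_graph :: "nat \<Rightarrow> (nat \<Rightarrow> nat \<Rightarrow> real) \<Rightarrow> bool" where
  "connected_graph n \<beta> \<longleftrightarrow> (\<forall>i<n. \<forall>j<n. (i, j) \<in> (pos_edges n \<beta>)\<^sup>*)"

definition laplacian :: "nat \<Rightarrow> (nat \<Rightarrow> nat \<Rightarrow> real) \<Rightarrow> real mat" where
  "laplacian n \<beta> = mat n n (\<lambda>(i, j). if i = j then \<Sum>l\<in>{0..<n} - {i}. \<beta> i l else - \<beta> i j)"

section \<open>Linear algebra\<close>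

definition ones :: "nat \<Rightarrow> real vec" where
  "ones n = vec n (\<lambda>_. 1)"

definition outer :: "real vec \<Rightarrow> real vec \<Rightarrow> real mat" where
  "outer v w = mat (dim_vec v) (dim_vec w) (\<lambda>(i, j). v $ i * w $ j)"

definition tr :: "real mat \<Rightarrow> real" where
  "tr A = (\<Sum>i<dim_row A. A $$ (i, i))"

definition is_pinv :: "real mat \<Rightarrow> real mat \<Rightarrow> bool" where
  "is_pinv A X \<longleftrightarrow> X \<in> carrier_mat (dim_col A) (dim_row A) \<and>
     A * X * A = A \<and> X * A * X = X \<and> (A * X)\<^sup>T = A * X \<and> (X * A)\<^sup>T = X * A"

text \<open>
  The Moore--Penrose pseudoinverse. For Laplacians of connected graphs, \<open>pinv_laplacian\<close> below
  shows that it exists and that it is \<open>(L + 1 1\<^sup>T / n)\<^sup>-\<^sup>1 - 1 1\<^sup>T / n\<close>.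
\<close>

definition pinv :: "real mat \<Rightarrow> real mat" where
  "pinv A = (THE X. is_pinv A X)"

section \<open>Losses\<close>

definition control_mat :: "nat \<Rightarrow> real vec \<Rightarrow> real mat" where
  "control_mat n \<alpha> = 1\<^sub>m n - outer \<alpha> (ones n)"

definition net_injection :: "nat \<Rightarrow> real vec \<Rightarrow> real vec \<Rightarrow> real vec \<Rightarrow> real vec" where
  "net_injection n \<mu> w \<alpha> = control_mat n \<alpha> *\<^sub>v (\<mu> + w)"

definition total_loss :: "nat \<Rightarrow> real mat \<Rightarrow> real vec \<Rightarrow> real vec \<Rightarrow> real vec \<Rightarrow> real" where
  "total_loss n L \<mu> w \<alpha> =
     1/2 * (net_injection n \<mu> w \<alpha> \<bullet> (pinv L *\<^sub>v net_injection n \<mu> w \<alpha>))"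

definition fluct_loss :: "nat \<Rightarrow> real mat \<Rightarrow> real vec \<Rightarrow> real vec \<Rightarrow> real vec \<Rightarrow> real" where
  "fluct_loss n L \<mu> w \<alpha> = total_loss n L \<mu> w \<alpha> - 1/2 * (\<mu> \<bullet> (pinv L *\<^sub>v \<mu>))"

definition equal_shares :: "nat \<Rightarrow> nat \<Rightarrow> real vec set" where
  "equal_shares n k =
     {(1 / real k) \<cdot>\<^sub>v finsum_vec TYPE(real) n (unit_vec n) B | B. B \<subseteq> {0..<n} \<and> card B = k}"

definition avg_fluct_loss ::
  "nat \<Rightarrow> real mat \<Rightarrow> real vec \<Rightarrow> 'a measure \<Rightarrow> ('a \<Rightarrow> real vec) \<Rightarrow> nat \<Rightarrow> real" where
  "avg_fluct_loss n L \<mu> M \<omega> k =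
     (\<Sum>\<alpha>\<in>equal_shares n k. \<integral>x. fluct_loss n L \<mu> (\<omega> x) \<alpha> \<partial>M) / real (card (equal_shares n k))"

definition cov_mat :: "nat \<Rightarrow> 'a measure \<Rightarrow> ('a \<Rightarrow> real vec) \<Rightarrow> real mat" where
  "cov_mat n M \<omega> = mat n n (\<lambda>(i, j). \<integral>x. \<omega> x $ i * \<omega> x $ j \<partial>M)"

definition aggregate_var :: "nat \<Rightarrow> real mat \<Rightarrow> real" where
  "aggregate_var n S = ones n \<bullet> (S *\<^sub>v ones n)"

definition gamma_ratio :: "nat \<Rightarrow> real mat \<Rightarrow> real mat \<Rightarrow> real" where
  "gamma_ratio n L S = (real n - 1) * tr (S * pinv L) / (aggregate_var n S * tr (pinv L))"

section \<open>The pseudoinverse of a Laplacian\<close>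

lemma is_pinv_unique:
  assumes X: "is_pinv A X" and Y: "is_pinv A Y"
  shows "X = Y"
proof -
  define r c where "r = dim_row A" and "c = dim_col A"
  have A [simp]: "A \<in> carrier_mat r c" and Xc [simp]: "X \<in> carrier_mat c r"
    and Yc [simp]: "Y \<in> carrier_mat c r"
    using X Y by (auto simp: is_pinv_def r_def c_def)
  have [simp]: "A * X \<in> carrier_mat r r" "A * Y \<in> carrier_mat r r"
    "X * A \<in> carrier_mat c c" "Y * A \<in> carrier_mat c c"
    by (rule mult_carrier_mat[OF A Xc] mult_carrier_mat[OF A Yc]
        mult_carrier_mat[OF Xc A] mult_carrier_mat[OF Yc A])+
  note x = X[unfolded is_pinv_def] and y = Y[unfolded is_pinv_def]
  have "A * X = (A * Y * A) * X" using y by simp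
  also have "\<dots> = (A * Y) * (A * X)"
    by (rule assoc_mult_mat[of _ r r _ c _ r]) auto
  also have "\<dots> = (A * Y)\<^sup>T * (A * X)\<^sup>T" using x y by simp
  also have "\<dots> = ((A * X) * (A * Y))\<^sup>T"
    by (rule transpose_mult[symmetric, of _ r r _ r]) auto
  also have "(A * X) * (A * Y) = (A * X * A) * Y"
    by (rule assoc_mult_mat[symmetric, of _ r r _ c _ r]) auto
  also have "(\<dots>)\<^sup>T = A * Y" using x y by simp
  finally have AX: "A * X = A * Y" .
  have "X * A = X * (A * Y * A)" using y by simp
  also have "\<dots> = X * (A * (Y * A))"
    by (subst assoc_mult_mat[of A r c Y r A c]) auto
  also have "\<dots> = (X * A) * (Y * A)"
    by (rule assoc_mult_mat[symmetric, of _ c r _ c _ c]) auto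
  also have "\<dots> = (X * A)\<^sup>T * (Y * A)\<^sup>T" using x y by simp
  also have "\<dots> = ((Y * A) * (X * A))\<^sup>T"
    by (rule transpose_mult[symmetric, of _ c c _ c]) auto
  also have "(Y * A) * (X * A) = Y * (A * (X * A))"
    by (rule assoc_mult_mat[of _ c r _ c _ c]) auto
  also have "A * (X * A) = A * X * A"
    by (rule assoc_mult_mat[symmetric, of _ r c _ r _ c]) auto
  also have "(Y * \<dots>)\<^sup>T = Y * A" using x y by simp
  finally have XA: "X * A = Y * A" .
  have "X = (X * A) * X" using x by simp
  also have "\<dots> = Y * (A * X)" unfolding XA by (rule assoc_mult_mat[of _ c r _ c _ r]) auto
  also have "\<dots> = (Y * A) * Y" unfolding AX by (rule assoc_mult_mat[symmetric, of _ c r _ c _ r]) auto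
  also have "\<dots> = Y" using y by simp
  finally show ?thesis .
qed

lemma pinv_eqI: "is_pinv A X \<Longrightarrow> pinv A = X"
  unfolding pinv_def using is_pinv_unique by blast

lemma laplacian_carrier [simp]: "laplacian n \<beta> \<in> carrier_mat n n"
  by (simp add: laplacian_def)

lemma laplacian_sym:
  assumes "weighted_graph n \<beta>"
  shows "(laplacian n \<beta>)\<^sup>T = laplacian n \<beta>"
  using assms by (intro eq_matI) (auto simp: laplacian_def weighted_graph_def)

lemma laplacian_mult_vec:
  assumes v: "v \<in> carrier_vec n" and i: "i < n"
  shows "(laplacian n \<beta> *\<^sub>v v) $ i = (\<Sum>j\<in>{0..<n} - {i}. \<beta> i j * (v $ i - v $ j))"
proof -
  have "(laplacian n \<beta> *\<^sub>v v) $ i =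
      (\<Sum>j\<in>{0..<n}. (if i = j then \<Sum>l\<in>{0..<n} - {i}. \<beta> i l else - \<beta> i j) * v $ j)"
    using v i by (auto simp: laplacian_def scalar_prod_def intro!: sum.cong)
  also have "\<dots> = (\<Sum>l\<in>{0..<n} - {i}. \<beta> i l) * v $ i
      + (\<Sum>j\<in>{0..<n} - {i}. (if i = j then \<Sum>l\<in>{0..<n} - {i}. \<beta> i l else - \<beta> i j) * v $ j)"
    by (subst sum.remove[of "{0..<n}" i]) (use i in auto)
  also have "(\<Sum>j\<in>{0..<n} - {i}. (if i = j then \<Sum>l\<in>{0..<n} - {i}. \<beta> i l else - \<beta> i j) * v $ j)
      = (\<Sum>j\<in>{0..<n} - {i}. - \<beta> i j * v $ j)"
    by (intro sum.cong) auto
  finally show ?thesis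
    by (simp add: sum_distrib_right right_diff_distrib sum_subtractf sum_negf)
qed

text \<open>A maximum principle replaces the quadratic form of \<open>L\<close> in the kernel computation.\<close>

lemma laplacian_kernel:
  assumes G: "weighted_graph n \<beta>" "connected_graph n \<beta>"
    and v: "v \<in> carrier_vec n" and 0: "laplacian n \<beta> *\<^sub>v v = 0\<^sub>v n"
    and ij: "i < n" "j < n"
  shows "v $ i = v $ j"
proof -
  define m where "m = Max ((\<lambda>i. v $ i) ` {0..<n})"
  have le: "v $ i \<le> m" if "i < n" for i
    unfolding m_def by (rule Max_ge) (use that in auto)
  have "m \<in> (\<lambda>i. v $ i) ` {0..<n}"
    unfolding m_def by (rule Max_in) (use ij in auto)
  then obtain a where a: "a < n" "v $ a = m" by auto
  have step: "v $ q = m" if "(p, q) \<in> pos_edges n \<beta>" "v $ p = m" for p q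
  proof -
    have p: "p < n" and q: "q < n" "p \<noteq> q" "0 < \<beta> p q"
      using that(1) by (auto simp: pos_edges_def)
    have "(\<Sum>j\<in>{0..<n} - {p}. \<beta> p j * (v $ p - v $ j)) = 0"
      using laplacian_mult_vec[OF v p, of \<beta>] 0 p by simp
    moreover have "0 \<le> \<beta> p j * (v $ p - v $ j)" if "j \<in> {0..<n} - {p}" for j
      using that G(1) p le[of j] \<open>v $ p = m\<close> by (auto simp: weighted_graph_def)
    ultimately have "\<forall>j\<in>{0..<n} - {p}. \<beta> p j * (v $ p - v $ j) = 0"
      by (subst (asm) sum_nonneg_eq_0_iff) auto
    hence "\<beta> p q * (v $ p - v $ q) = 0" by (rule bspec) (use q in simp)
    thus ?thesis using q that(2) by simp
  qed
  have all: "v $ q = m" if "q < n" for q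
  proof -
    have "(a, q) \<in> (pos_edges n \<beta>)\<^sup>*" using G(2) a that by (auto simp: connected_graph_def)
    thus ?thesis by (induction rule: rtrancl_induct) (use a(2) in simp, rule step)
  qed
  show ?thesis using all ij by simp
qed

definition avg_mat :: "nat \<Rightarrow> real mat" where
  "avg_mat n = (1 / real n) \<cdot>\<^sub>m outer (ones n) (ones n)"

lemma avg_mat_carrier [simp]: "avg_mat n \<in> carrier_mat n n"
  by (simp add: avg_mat_def outer_def ones_def)

lemma avg_mat_index [simp]: "i < n \<Longrightarrow> j < n \<Longrightarrow> avg_mat n $$ (i, j) = 1 / real n"
  by (simp add: avg_mat_def outer_def ones_def)

lemma avg_mat_sym: "(avg_mat n)\<^sup>T = avg_mat n"
  by (intro eq_matI) (auto simp: avg_mat_def outer_def ones_def)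

lemma avg_mat_idem: "avg_mat n * avg_mat n = avg_mat n"
  by (intro eq_matI) (auto simp: avg_mat_def outer_def ones_def scalar_prod_def)

lemma laplacian_avg_mat: "laplacian n \<beta> * avg_mat n = 0\<^sub>m n n"
proof (intro eq_matI)
  fix i j assume "i < dim_row (0\<^sub>m n n :: real mat)" "j < dim_col (0\<^sub>m n n :: real mat)"
  hence ij: "i < n" "j < n" by auto
  have "(laplacian n \<beta> * avg_mat n) $$ (i, j) = (laplacian n \<beta> *\<^sub>v vec n (\<lambda>_. 1 / real n)) $ i"
    using ij by (auto simp: scalar_prod_def laplacian_def avg_mat_def outer_def ones_def
        intro!: sum.cong)
  also have "\<dots> = 0"
    using ij by (subst laplacian_mult_vec) (auto intro!: sum.neutral)
  finally show "(laplacian n \<beta> * avg_mat n) $$ (i, j) = 0\<^sub>m n n $$ (i, j)"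
    using ij by simp
qed (auto simp: laplacian_def avg_mat_def outer_def ones_def)

lemma avg_mat_laplacian:
  assumes "weighted_graph n \<beta>"
  shows "avg_mat n * laplacian n \<beta> = 0\<^sub>m n n"
proof -
  have "(laplacian n \<beta> * avg_mat n)\<^sup>T = (avg_mat n)\<^sup>T * (laplacian n \<beta>)\<^sup>T"
    by (rule transpose_mult[of _ n n _ n]) auto
  moreover have "(0\<^sub>m n n :: real mat)\<^sup>T = 0\<^sub>m n n"
    by (intro eq_matI) auto
  ultimately show ?thesis
    by (simp add: laplacian_avg_mat avg_mat_sym laplacian_sym[OF assms])
qed

lemma laplacian_plus_avg_mat_kernel:
  assumes G: "weighted_graph n \<beta>" "connected_graph n \<beta>"
    and v: "v \<in> carrier_vec n" and 0: "(laplacian n \<beta> + avg_mat n) *\<^sub>v v = 0\<^sub>v n"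
  shows "v = 0\<^sub>v n"
proof (cases "n = 0")
  case True
  thus ?thesis using v by auto
next
  case False
  let ?L = "laplacian n \<beta>" and ?J = "avg_mat n"
  have "?J *\<^sub>v ((?L + ?J) *\<^sub>v v) = (?J * (?L + ?J)) *\<^sub>v v"
    by (rule assoc_mult_mat_vec[symmetric, of _ n n _ n]) (use v in auto)
  also have "?J * (?L + ?J) = ?J"
    by (subst mult_add_distrib_mat[of _ n n _ n])
       (simp_all add: avg_mat_laplacian[OF G(1)] avg_mat_idem left_add_zero_mat[of _ n n])
  finally have J0: "?J *\<^sub>v v = 0\<^sub>v n"
    unfolding 0 by (simp add: mult_mat_vec_def scalar_prod_def carrier_matD[OF avg_mat_carrier]
        zero_vec_def)
  have "(?L + ?J) *\<^sub>v v = ?L *\<^sub>v v + ?J *\<^sub>v v"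
    by (rule add_mult_distrib_mat_vec[of _ n n]) (use v in auto)
  hence L0: "?L *\<^sub>v v = 0\<^sub>v n"
    using 0 J0 by (simp add: right_zero_vec[of _ n] mult_mat_vec_carrier[OF laplacian_carrier v])
  have const: "v $ i = v $ 0" if "i < n" for i
    using laplacian_kernel[OF G v L0 that] False by simp
  have "(?J *\<^sub>v v) $ 0 = (\<Sum>i\<in>{0..<n}. 1 / real n * v $ i)"
    using False v by (auto simp: avg_mat_def outer_def ones_def scalar_prod_def intro!: sum.cong)
  also have "\<dots> = (\<Sum>i\<in>{0..<n}. 1 / real n * v $ 0)"
    by (intro sum.cong refl arg_cong[where f = "\<lambda>y. _ * y"] const) simp
  also have "\<dots> = v $ 0" using False by simp
  finally have "v $ 0 = 0" using J0 False by simp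
  hence "v $ i = 0" if "i < n" for i
    using const[OF that] by metis
  thus ?thesis using v by (intro eq_vecI) auto
qed

lemma pinv_laplacian:
  assumes G: "weighted_graph n \<beta>" "connected_graph n \<beta>"
  shows "is_pinv (laplacian n \<beta>) (pinv (laplacian n \<beta>))"
    and "\<exists>N. mat_inverse (laplacian n \<beta> + avg_mat n) = Some N \<and>
           pinv (laplacian n \<beta>) = N - avg_mat n"
proof -
  define L J where "L = laplacian n \<beta>" and "J = avg_mat n"
  have c [simp]: "L \<in> carrier_mat n n" "J \<in> carrier_mat n n" "L + J \<in> carrier_mat n n"
    by (auto simp: L_def J_def)
  have "det (L + J) \<noteq> 0"
    using laplacian_plus_avg_mat_kernel[OF G]
    by (subst det_0_iff_vec_prod_zero_field[of _ n]) (auto simp: L_def J_def)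
  hence "L + J \<in> Units (ring_mat TYPE(real) n ())"
    by (intro det_non_zero_imp_unit) auto
  then obtain N where N: "mat_inverse (L + J) = Some N"
    using mat_inverse(1)[of "L + J" n "()"] by (cases "mat_inverse (L + J)") auto
  from mat_inverse(2)[OF c(3) N] have MN: "(L + J) * N = 1\<^sub>m n" and NM: "N * (L + J) = 1\<^sub>m n"
    and Nc [simp]: "N \<in> carrier_mat n n" by auto
  have LJ: "L * J = 0\<^sub>m n n" and JL: "J * L = 0\<^sub>m n n" and JJ: "J * J = J"
    using laplacian_avg_mat avg_mat_laplacian[OF G(1)] avg_mat_idem by (auto simp: L_def J_def)
  have Js: "J\<^sup>T = J" by (simp add: J_def avg_mat_sym)
  have MJ: "(L + J) * J = J"
    by (simp add: add_mult_distrib_mat[of _ n n _ _ n] LJ JJ left_add_zero_mat[of _ n n])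
  have JM: "J * (L + J) = J"
    by (simp add: mult_add_distrib_mat[of _ n n _ n] JL JJ left_add_zero_mat[of _ n n])
  have NJ: "N * J = J"
  proof -
    have "N * J = N * ((L + J) * J)" by (simp add: MJ)
    also have "\<dots> = (N * (L + J)) * J"
      by (rule assoc_mult_mat[symmetric, of _ n n _ n _ n]) auto
    finally show ?thesis by (simp add: NM left_mult_one_mat[of _ n n])
  qed
  have JN: "J * N = J"
  proof -
    have "J * N = (J * (L + J)) * N" by (simp add: JM)
    also have "\<dots> = J * ((L + J) * N)"
      by (rule assoc_mult_mat[of _ n n _ n _ n]) auto
    finally show ?thesis by (simp add: MN right_mult_one_mat[of _ n n])
  qed
  define X where "X = N - J"
  have Xc [simp]: "X \<in> carrier_mat n n" unfolding X_def by (rule minus_carrier_mat) simp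
  have JX: "J * X = 0\<^sub>m n n"
    by (simp add: X_def mult_minus_distrib_mat[of _ n n _ n] JN JJ minus_r_inv_mat[of _ n n])
  have XJ: "X * J = 0\<^sub>m n n"
    by (simp add: X_def minus_mult_distrib_mat[of _ n n _ _ n] NJ JJ minus_r_inv_mat[of _ n n])
  have cancel: "A + J - J = A" if "A \<in> carrier_mat n n" for A
    using that carrier_matD[OF c(2)] by (intro eq_matI) auto
  have LN: "L * N = 1\<^sub>m n - J"
  proof -
    have "1\<^sub>m n = L * N + J"
      using MN by (simp add: add_mult_distrib_mat[of _ n n _ _ n] JN)
    moreover have "L * N + J - J = L * N"
      by (intro cancel mult_carrier_mat[of _ n n]) auto
    ultimately show ?thesis by simp
  qed
  have NL: "N * L = 1\<^sub>m n - J"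
  proof -
    have "1\<^sub>m n = N * L + J"
      using NM by (simp add: mult_add_distrib_mat[of _ n n _ n] NJ)
    moreover have "N * L + J - J = N * L"
      by (intro cancel mult_carrier_mat[of _ n n]) auto
    ultimately show ?thesis by simp
  qed
  have z: "A - 0\<^sub>m n n = A" if "A \<in> carrier_mat n n" for A :: "real mat"
    using that by (intro eq_matI) auto
  have IJ: "1\<^sub>m n - J \<in> carrier_mat n n"
    by (rule minus_carrier_mat) simp
  have LX: "L * X = 1\<^sub>m n - J"
    by (simp add: X_def mult_minus_distrib_mat[of _ n n _ n] LN LJ z IJ)
  have XL: "X * L = 1\<^sub>m n - J"
    by (simp add: X_def minus_mult_distrib_mat[of _ n n _ _ n] NL JL z IJ)
  have s: "(1\<^sub>m n - J)\<^sup>T = 1\<^sub>m n - J"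
    by (simp add: transpose_minus[of _ n n] Js)
  have "is_pinv L X"
    unfolding is_pinv_def LX XL s
    by (simp add: carrier_matD[of L n n] minus_mult_distrib_mat[of _ n n _ _ n] JL JX z
        left_mult_one_mat[of _ n n])
  hence "pinv L = X" by (rule pinv_eqI)
  thus "is_pinv (laplacian n \<beta>) (pinv (laplacian n \<beta>))"
    and "\<exists>N. mat_inverse (laplacian n \<beta> + avg_mat n) = Some N \<and>
           pinv (laplacian n \<beta>) = N - avg_mat n"
    using \<open>is_pinv L X\<close> N by (auto simp: L_def J_def X_def)
qed

end

theory Submission
  imports Defs
begin

text \<open>
  Write \<open>P\<close> for the pseudoinverse of the Laplacian and \<open>\<Sigma>\<close> for the covariance matrix. Taking
  expectations, all terms of the fluctuation loss that are linear in \<open>\<omega>\<close> vanish. Averaging over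
  the \<open>k\<close>-subsets removes the terms linear in \<open>\<alpha>\<close>, because the average of \<open>\<alpha>\<close> is a multiple of
  the all-ones vector, on which \<open>P\<close> vanishes. As \<open>P\<close> has zero row sums, its off-diagonal entries sum
  to \<open>- tr P\<close>, and counting the subsets that contain one or two given nodes yields
  \<open>H\<^sub>k = 1/2 (tr (\<Sigma> P) + \<sigma>\<^sup>2 tr P (n - k) / (k n (n - 1)))\<close>.
  Dividing by \<open>\<sigma>\<^sup>2 tr P / (2 (n - 1))\<close>, which is legitimate because \<open>tr P \<noteq> 0\<close>, turns \<open>H\<^sub>k / H\<^sub>1\<close> into
  \<open>(\<gamma>\<^sub>n + (n - k) / (k n)) / (\<gamma>\<^sub>n + (n - 1) / n)\<close>.
  For i.i.d. loads \<open>\<Sigma>\<close> is a multiple of the identity, so \<open>\<gamma>\<^sub>n = (n - 1) / n\<close>.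
\<close>

section \<open>Laplacians and their pseudoinverses\<close>

lemma scalar_prod_mult_mat_vec_eq_sum:
  fixes A :: "real mat"
  assumes "A \<in> carrier_mat n n" "v \<in> carrier_vec n" "w \<in> carrier_vec n"
  shows "v \<bullet> (A *\<^sub>v w) = (\<Sum>i\<in>{0..<n}. \<Sum>j\<in>{0..<n}. A $$ (i, j) * (v $ i * w $ j))"
  using assms by (auto simp: scalar_prod_def sum_distrib_left mult.left_commute intro!: sum.cong)

lemma tr_mult_eq_sum:
  assumes "A \<in> carrier_mat n n" "B \<in> carrier_mat n n"
  shows "tr (A * B) = (\<Sum>i\<in>{0..<n}. \<Sum>j\<in>{0..<n}. A $$ (i, j) * B $$ (j, i))"
  using assms by (auto simp: tr_def scalar_prod_def lessThan_atLeast0 intro!: sum.cong)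

section \<open>The Laplacian: constant vectors and the quadratic form\<close>

lemma laplacian_ones: "laplacian n \<beta> *\<^sub>v ones n = 0\<^sub>v n"
proof (rule eq_vecI)
  fix i assume "i < dim_vec (0\<^sub>v n :: real vec)"
  hence i: "i < n" by simp
  show "(laplacian n \<beta> *\<^sub>v ones n) $ i = 0\<^sub>v n $ i"
    using i by (subst laplacian_mult_vec) (auto simp: ones_def intro!: sum.neutral)
qed (simp add: carrier_matD[OF laplacian_carrier])

text \<open>The Dirichlet energy of the graph. Exchanging \<open>i\<close> and \<open>j\<close> and
  adding the two sums turns \<open>v $ i * (v $ i - v $ j)\<close> into a square; the double sum
  meets every edge twice, hence the factor 2.\<close>

lemma laplacian_quadratic_form:
  assumes G: "weighted_graph n \<beta>" and v: "v \<in> carrier_vec n"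
  shows "2 * (v \<bullet> (laplacian n \<beta> *\<^sub>v v)) =
    (\<Sum>i\<in>{0..<n}. \<Sum>j\<in>{0..<n} - {i}. \<beta> i j * (v $ i - v $ j)\<^sup>2)"
proof -
  \<comment> \<open>The diagonal of \<open>\<beta>\<close> is arbitrary; zeroing it lets the inner
    sum run over all nodes, so that the two sums can be exchanged.\<close>
  define b where "b i j = (if i = j then 0 else \<beta> i j)" for i j
  have b_sym: "b i j = b j i" if "i < n" "j < n" for i j
    using G that by (auto simp: weighted_graph_def b_def)
  have drop: "(\<Sum>j\<in>{0..<n} - {i}. \<beta> i j * f j) = (\<Sum>j\<in>{0..<n}. b i j * f j)"
    for i and f :: "nat \<Rightarrow> real"
    by (rule sum.mono_neutral_cong_left) (auto simp: b_def)
  let ?S = "\<Sum>i\<in>{0..<n}. \<Sum>j\<in>{0..<n}. b i j * (v $ i * (v $ i - v $ j))"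
  have form: "v \<bullet> (laplacian n \<beta> *\<^sub>v v) = ?S"
    using v unfolding scalar_prod_def
    by (auto simp: laplacian_mult_vec drop sum_distrib_left mult_ac
        carrier_matD[OF laplacian_carrier] simp del: index_mult_mat_vec intro!: sum.cong)
  have swap: "?S = (\<Sum>i\<in>{0..<n}. \<Sum>j\<in>{0..<n}. b i j * (v $ j * (v $ j - v $ i)))"
    by (subst sum.swap) (auto simp: b_sym intro!: sum.cong)
  have "2 * ?S = ?S + (\<Sum>i\<in>{0..<n}. \<Sum>j\<in>{0..<n}. b i j * (v $ j * (v $ j - v $ i)))"
    using swap by linarith
  also have "\<dots> = (\<Sum>i\<in>{0..<n}. \<Sum>j\<in>{0..<n}. b i j * (v $ i - v $ j)\<^sup>2)"
    by (simp add: sum.distrib[symmetric] power2_eq_square algebra_simps)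
  finally show ?thesis by (simp add: form drop)
qed

lemma laplacian_quadratic_form_nonneg:
  assumes "weighted_graph n \<beta>" "v \<in> carrier_vec n"
  shows "0 \<le> v \<bullet> (laplacian n \<beta> *\<^sub>v v)"
proof -
  have "0 \<le> 2 * (v \<bullet> (laplacian n \<beta> *\<^sub>v v))"
    unfolding laplacian_quadratic_form[OF assms] using assms(1)
    by (intro sum_nonneg mult_nonneg_nonneg) (auto simp: weighted_graph_def)
  thus ?thesis by simp
qed

text \<open>All summands of the energy are nonnegative, so each of them is zero. Then every
  \<open>\<beta> i j * (v $ i - v $ j)\<close> is zero as well, and these are the summands of the
  entries of \<open>L v\<close>.\<close>

lemma laplacian_quadratic_form_eq_0:
  assumes G: "weighted_graph n \<beta>" and v: "v \<in> carrier_vec n"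
    and 0: "v \<bullet> (laplacian n \<beta> *\<^sub>v v) = 0"
  shows "laplacian n \<beta> *\<^sub>v v = 0\<^sub>v n"
proof (rule eq_vecI)
  have nn: "0 \<le> \<beta> i j * (v $ i - v $ j)\<^sup>2" if "i < n" "j \<in> {0..<n} - {i}" for i j
    using G that by (auto simp: weighted_graph_def)
  fix i assume "i < dim_vec (0\<^sub>v n :: real vec)"
  hence i: "i < n" by simp
  have "(\<Sum>i\<in>{0..<n}. \<Sum>j\<in>{0..<n} - {i}. \<beta> i j * (v $ i - v $ j)\<^sup>2) = 0"
    using laplacian_quadratic_form[OF G v] 0 by simp
  hence "(\<Sum>j\<in>{0..<n} - {i}. \<beta> i j * (v $ i - v $ j)\<^sup>2) = 0"
    using i by (subst (asm) sum_nonneg_eq_0_iff) (auto intro!: sum_nonneg nn)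
  hence "\<forall>j\<in>{0..<n} - {i}. \<beta> i j * (v $ i - v $ j)\<^sup>2 = 0"
    using i nn by (subst (asm) sum_nonneg_eq_0_iff) auto
  hence "(\<Sum>j\<in>{0..<n} - {i}. \<beta> i j * (v $ i - v $ j)) = 0"
    by (intro sum.neutral) auto
  thus "(laplacian n \<beta> *\<^sub>v v) $ i = 0\<^sub>v n $ i"
    using i v by (simp add: laplacian_mult_vec del: index_mult_mat_vec)
qed (simp add: carrier_matD[OF laplacian_carrier])

text \<open>Otherwise a unit vector would lie in the kernel, which by connectedness contains only
  constant vectors; with two nodes or more a unit vector is not constant.\<close>

lemma laplacian_neq_0:
  assumes G: "weighted_graph n \<beta>" "connected_graph n \<beta>" and n: "2 \<le> n"
  shows "laplacian n \<beta> \<noteq> 0\<^sub>m n n"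
proof
  assume "laplacian n \<beta> = 0\<^sub>m n n"
  hence "laplacian n \<beta> *\<^sub>v unit_vec n 0 = 0\<^sub>v n" by auto
  from laplacian_kernel[OF G _ this, of 0 1] n show False by (simp add: unit_vec_def)
qed

section \<open>The pseudoinverse: symmetry, zero row sums, nonzero trace\<close>

lemma pinv_laplacian_carrier:
  assumes "weighted_graph n \<beta>" "connected_graph n \<beta>"
  shows "pinv (laplacian n \<beta>) \<in> carrier_mat n n"
  using pinv_laplacian(1)[OF assms] by (simp add: is_pinv_def carrier_matD[OF laplacian_carrier])

text \<open>Since \<open>L\<close> is symmetric, the transpose of \<open>P\<close> satisfies the
  same four Penrose equations, and their solution is unique.\<close>

lemma pinv_laplacian_sym:
  assumes G: "weighted_graph n \<beta>" "connected_graph n \<beta>"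
  shows "(pinv (laplacian n \<beta>))\<^sup>T = pinv (laplacian n \<beta>)"
proof -
  define L P where "L = laplacian n \<beta>" and "P = pinv (laplacian n \<beta>)"
  have c: "L \<in> carrier_mat n n" "P \<in> carrier_mat n n" "P\<^sup>T \<in> carrier_mat n n"
    using pinv_laplacian_carrier[OF G] by (auto simp: L_def P_def)
  have LT: "L\<^sup>T = L" using laplacian_sym[OF G(1)] by (simp add: L_def)
  have P: "L * P * L = L" "P * L * P = P" "(L * P)\<^sup>T = L * P" "(P * L)\<^sup>T = P * L"
    using pinv_laplacian(1)[OF G] by (auto simp: is_pinv_def L_def P_def)
  \<comment> \<open>Transposing \<open>L * P\<close> reverses the factors, while the Penrose
    symmetry leaves the product unchanged; likewise for \<open>P * L\<close>.\<close>
  have PTL: "P\<^sup>T * L = L * P" and LPT: "L * P\<^sup>T = P * L"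
    using transpose_mult[OF c(1,2)] transpose_mult[OF c(2,1)] P LT by simp_all
  have "L * P\<^sup>T * L = L * (P\<^sup>T * L)" by (rule assoc_mult_mat[OF c(1,3,1)])
  also have "\<dots> = (L * P * L)\<^sup>T"
    using transpose_mult[OF mult_carrier_mat[OF c(1,2)] c(1)] P LT PTL by simp
  finally have 1: "L * P\<^sup>T * L = L" using P LT by simp
  have "P\<^sup>T * L * P\<^sup>T = P\<^sup>T * (L * P\<^sup>T)" by (rule assoc_mult_mat[OF c(3,1,3)])
  also have "\<dots> = (P * L * P)\<^sup>T"
    using transpose_mult[OF mult_carrier_mat[OF c(2,1)] c(2)] P LPT by simp
  finally have 2: "P\<^sup>T * L * P\<^sup>T = P\<^sup>T" using P by simp
  have "is_pinv L (P\<^sup>T)"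
    using 1 2 P PTL LPT c carrier_matD[OF c(1)] by (simp add: is_pinv_def)
  from pinv_eqI[OF this] show ?thesis unfolding L_def P_def by (rule sym)
qed

text \<open>By symmetry \<open>P\<close> and \<open>L\<close> commute, so
  \<open>P = P * (P * L)\<close>, and \<open>L\<close> annihilates the all-ones vector.\<close>

lemma pinv_laplacian_ones:
  assumes G: "weighted_graph n \<beta>" "connected_graph n \<beta>"
  shows "pinv (laplacian n \<beta>) *\<^sub>v ones n = 0\<^sub>v n"
proof -
  define L P where "L = laplacian n \<beta>" and "P = pinv (laplacian n \<beta>)"
  have c: "L \<in> carrier_mat n n" "P \<in> carrier_mat n n"
    using pinv_laplacian_carrier[OF G] by (auto simp: L_def P_def)
  have T: "L\<^sup>T = L" "P\<^sup>T = P"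
    using laplacian_sym[OF G(1)] pinv_laplacian_sym[OF G] by (simp_all add: L_def P_def)
  have P: "P * L * P = P" "(L * P)\<^sup>T = L * P"
    using pinv_laplacian(1)[OF G] by (auto simp: is_pinv_def L_def P_def)
  have ones: "ones n \<in> carrier_vec n" by (simp add: ones_def)
  have "P = P * (L * P)"
    using P(1) assoc_mult_mat[OF c(2) c(1) c(2)] by simp
  also have "L * P = P * L"
    using transpose_mult[OF c] P(2) T by simp
  finally have "P *\<^sub>v ones n = P * (P * L) *\<^sub>v ones n" by simp
  also have "\<dots> = P *\<^sub>v (P *\<^sub>v (L *\<^sub>v ones n))"
    using assoc_mult_mat_vec[OF c(2) mult_carrier_mat[OF c(2,1)] ones]
      assoc_mult_mat_vec[OF c(2,1) ones] by simp
  also have "\<dots> = 0\<^sub>v n"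
  proof -
    have "P *\<^sub>v 0\<^sub>v n = 0\<^sub>v n" using c by (intro eq_vecI) auto
    thus ?thesis by (simp add: L_def laplacian_ones)
  qed
  finally show ?thesis by (simp add: P_def)
qed

lemma pinv_laplacian_row_sum:
  assumes G: "weighted_graph n \<beta>" "connected_graph n \<beta>" and i: "i < n"
  shows "(\<Sum>j\<in>{0..<n}. pinv (laplacian n \<beta>) $$ (i, j)) = 0"
  using arg_cong[OF pinv_laplacian_ones[OF G], of "\<lambda>v. v $ i"] i
    carrier_matD[OF pinv_laplacian_carrier[OF G]]
  by (simp add: scalar_prod_def ones_def)

lemma pinv_laplacian_col_sum:
  assumes G: "weighted_graph n \<beta>" "connected_graph n \<beta>" and j: "j < n"
  shows "(\<Sum>i\<in>{0..<n}. pinv (laplacian n \<beta>) $$ (i, j)) = 0"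
proof -
  have "pinv (laplacian n \<beta>) $$ (i, j) = pinv (laplacian n \<beta>) $$ (j, i)" if "i < n" for i
    using that j carrier_matD[OF pinv_laplacian_carrier[OF G]]
    by (subst pinv_laplacian_sym[OF G, symmetric]) simp
  thus ?thesis using pinv_laplacian_row_sum[OF G j] by simp
qed

text \<open>From \<open>P = P\<^sup>T * (L * P)\<close>, the diagonal entries of \<open>P\<close>
  are the energies of its columns. If they summed to zero, every column would be in the kernel of
  \<open>L\<close>, so \<open>L * P = 0\<close> and \<open>L = L * P * L = 0\<close>. The trace
  occurs as a denominator in \<open>gamma_ratio\<close>.\<close>

lemma tr_pinv_laplacian_neq_0:
  assumes G: "weighted_graph n \<beta>" "connected_graph n \<beta>" and n: "2 \<le> n"
  shows "tr (pinv (laplacian n \<beta>)) \<noteq> 0"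
proof
  define L P where "L = laplacian n \<beta>" and "P = pinv (laplacian n \<beta>)"
  have c: "L \<in> carrier_mat n n" "P \<in> carrier_mat n n"
    using pinv_laplacian_carrier[OF G] by (auto simp: L_def P_def)
  have P: "L * P * L = L" "P * L * P = P" and PT: "P\<^sup>T = P"
    using pinv_laplacian(1)[OF G] pinv_laplacian_sym[OF G]
    by (auto simp: is_pinv_def L_def P_def)
  have diag: "P $$ (i, i) = col P i \<bullet> (L *\<^sub>v col P i)" if i: "i < n" for i
  proof -
    have "P = P\<^sup>T * (L * P)"
      using P(2) PT assoc_mult_mat[OF c(2,1,2)] by simp
    hence "P $$ (i, i) = (P\<^sup>T * (L * P)) $$ (i, i)" by simp
    also have "\<dots> = col P i \<bullet> col (L * P) i"
      using i carrier_matD[OF c(1)] carrier_matD[OF c(2)] by simp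
    also have "col (L * P) i = L *\<^sub>v col P i"
      using i by (intro col_mult2[OF c])
    finally show ?thesis .
  qed
  have col: "col P i \<in> carrier_vec n" for i using c by auto
  assume "tr (pinv (laplacian n \<beta>)) = 0"
  hence "(\<Sum>i<n. col P i \<bullet> (L *\<^sub>v col P i)) = 0"
    using diag carrier_matD[OF c(2)] by (simp add: tr_def P_def)
  hence "\<forall>i<n. col P i \<bullet> (L *\<^sub>v col P i) = 0"
    using laplacian_quadratic_form_nonneg[OF G(1) col]
    by (subst (asm) sum_nonneg_eq_0_iff) (auto simp: L_def)
  hence null: "L *\<^sub>v col P i = 0\<^sub>v n" if "i < n" for i
    using laplacian_quadratic_form_eq_0[OF G(1) col] that by (simp add: L_def)
  have "L * P = 0\<^sub>m n n"
  proof (rule eq_matI)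
    fix i j assume "i < dim_row (0\<^sub>m n n :: real mat)" "j < dim_col (0\<^sub>m n n :: real mat)"
    hence ij: "i < n" "j < n" by auto
    have "(L * P) $$ (i, j) = (L *\<^sub>v col P j) $ i"
      using ij carrier_matD[OF c(1)] carrier_matD[OF c(2)] by simp
    thus "(L * P) $$ (i, j) = 0\<^sub>m n n $$ (i, j)" using ij null by simp
  qed (use c in auto)
  hence "L = 0\<^sub>m n n" using P(1) c by simp
  thus False using laplacian_neq_0[OF G n] by (simp add: L_def)
qed

section \<open>Averages over sets of \<open>k\<close> equally sharing nodes\<close>

text \<open>Removing \<open>T\<close> is a bijection onto the subsets of \<open>V - T\<close> of
  size \<open>k - card T\<close>, with inverse adding \<open>T\<close>. The bound on
  \<open>card T\<close> keeps the natural subtraction exact.\<close>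

lemma card_supersets_of_card:
  assumes "finite V" "T \<subseteq> V" "card T \<le> k"
  shows "card {B. B \<subseteq> V \<and> card B = k \<and> T \<subseteq> B} = (card V - card T) choose (k - card T)"
proof -
  have fin: "finite T" "finite (V - T)" using assms finite_subset by auto
  have "bij_betw (\<lambda>B. B - T) {B. B \<subseteq> V \<and> card B = k \<and> T \<subseteq> B}
      {C. C \<subseteq> V - T \<and> card C = k - card T}"
  proof (rule bij_betw_byWitness[where f' = "\<lambda>C. C \<union> T"])
    show "(\<lambda>B. B - T) ` {B. B \<subseteq> V \<and> card B = k \<and> T \<subseteq> B} \<subseteq> {C. C \<subseteq> V - T \<and> card C = k - card T}"
      using fin by (auto simp: card_Diff_subset)
    show "(\<lambda>C. C \<union> T) ` {C. C \<subseteq> V - T \<and> card C = k - card T} \<subseteq> {B. B \<subseteq> V \<and> card B = k \<and> T \<subseteq> B}"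
    proof clarsimp
      fix C assume C: "C \<subseteq> V - T" "card C = k - card T"
      hence "card (C \<union> T) = card C + card T"
        using fin finite_subset[OF C(1)] by (intro card_Un_disjoint) auto
      thus "C \<subseteq> V \<and> T \<subseteq> V \<and> card (C \<union> T) = k" using C assms by auto
    qed
  qed auto
  hence "card {B. B \<subseteq> V \<and> card B = k \<and> T \<subseteq> B} = card {C. C \<subseteq> V - T \<and> card C = k - card T}"
    by (rule bij_betw_same_card)
  also have "\<dots> = card (V - T) choose (k - card T)"
    using fin by (intro n_subsets)
  finally show ?thesis using fin assms by (simp add: card_Diff_subset)
qed

text \<open>The absorption identity for binomial coefficients, kept free of quotients.\<close>

lemma card_subsets_containing:
  assumes "1 \<le> k" "i < n"
  shows "real n * card {B. B \<subseteq> {0..<n} \<and> card B = k \<and> i \<in> B} = real k * (n choose k)"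
proof -
  have "card {B. B \<subseteq> {0..<n} \<and> card B = k \<and> i \<in> B} = (n - 1) choose (k - 1)"
    using card_supersets_of_card[of "{0..<n}" "{i}" k] assms by simp
  thus ?thesis
    using times_binomial_minus1_eq[of k n] assms by (simp flip: of_nat_mult)
qed

text \<open>Absorption applied twice, from \<open>n choose k\<close> down to
  \<open>(n - 2) choose (k - 2)\<close>.\<close>

lemma card_subsets_containing_pair:
  assumes "1 \<le> k" "i < n" "j < n" "i \<noteq> j"
  shows "real n * (real n - 1) * card {B. B \<subseteq> {0..<n} \<and> card B = k \<and> i \<in> B \<and> j \<in> B}
    = real k * (real k - 1) * (n choose k)"
proof (cases "k = 1")
  \<comment> \<open>Here \<open>k - 2\<close> would be truncated to 0 and the binomial coefficient
    would be 1, although no singleton contains two distinct nodes.\<close>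
  case True
  have "{B. B \<subseteq> {0..<n} \<and> card B = k \<and> i \<in> B \<and> j \<in> B} = {}"
    using True assms by (auto simp: card_1_singleton_iff)
  thus ?thesis using True by (simp only: card.empty) simp
next
  case False
  have "card {B. B \<subseteq> {0..<n} \<and> card B = k \<and> i \<in> B \<and> j \<in> B} = (n - 2) choose (k - 2)"
    using card_supersets_of_card[of "{0..<n}" "{i, j}" k] assms False
    by (simp add: numeral_2_eq_2)
  moreover have "k * (n choose k) = n * ((n - 1) choose (k - 1))"
    using times_binomial_minus1_eq[of k n] assms by simp
  moreover have "(k - 1) * ((n - 1) choose (k - 1)) = (n - 1) * ((n - 2) choose (k - 2))"
    using times_binomial_minus1_eq[of "k - 1" "n - 1"] assms False by (simp add: numeral_2_eq_2)
  ultimately have "(k - 1) * (k * (n choose k)) =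
      n * ((n - 1) * card {B. B \<subseteq> {0..<n} \<and> card B = k \<and> i \<in> B \<and> j \<in> B})"
    by (metis mult.left_commute)
  hence "real (k - 1) * (real k * (n choose k))
      = real n * (real (n - 1) * card {B. B \<subseteq> {0..<n} \<and> card B = k \<and> i \<in> B \<and> j \<in> B})"
    by (simp only: flip: of_nat_mult)
  thus ?thesis using assms by (simp add: of_nat_diff algebra_simps)
qed

section \<open>Equal shares as vectors indexed by node sets\<close>

definition equal_share :: "nat \<Rightarrow> nat \<Rightarrow> nat set \<Rightarrow> real vec" where
  "equal_share n k B = (1 / real k) \<cdot>\<^sub>v finsum_vec TYPE(real) n (unit_vec n) B"

lemma equal_share_carrier [simp]:
  assumes "B \<subseteq> {0..<n}"
  shows "equal_share n k B \<in> carrier_vec n"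
  using assms by (auto simp: equal_share_def intro!: finsum_vec_closed)

lemma equal_share_index:
  assumes "B \<subseteq> {0..<n}" "i < n"
  shows "equal_share n k B $ i = of_bool (i \<in> B) / real k"
proof -
  have fin: "finite B" using assms finite_subset by blast
  have "finsum_vec TYPE(real) n (unit_vec n) B $ i = (\<Sum>j\<in>B. unit_vec n j $ i)"
    using fin assms by (intro index_finsum_vec) auto
  also have "\<dots> = (\<Sum>j\<in>B. if j = i then 1 else 0)"
    using assms by (intro sum.cong) (auto simp: unit_vec_def)
  also have "\<dots> = of_bool (i \<in> B)" using fin by simp
  finally have "finsum_vec TYPE(real) n (unit_vec n) B $ i = of_bool (i \<in> B)" .
  moreover have "finsum_vec TYPE(real) n (unit_vec n) B \<in> carrier_vec n"
    using assms by (intro finsum_vec_closed) auto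
  ultimately show ?thesis
    using assms(2) by (simp add: equal_share_def)
qed

text \<open>The support of the vector is \<open>B\<close>, because \<open>1 / k\<close> is nonzero.
  Hence averaging over the set of vectors is the same as averaging over the
  \<open>k\<close>-subsets.\<close>

lemma equal_share_inj:
  assumes "1 \<le> k"
  shows "inj_on (equal_share n k) {B. B \<subseteq> {0..<n} \<and> card B = k}"
proof (rule inj_onI)
  fix B C assume "B \<in> {B. B \<subseteq> {0..<n} \<and> card B = k}" "C \<in> {B. B \<subseteq> {0..<n} \<and> card B = k}"
    and eq: "equal_share n k B = equal_share n k C"
  hence B: "B \<subseteq> {0..<n}" and C: "C \<subseteq> {0..<n}" by auto
  have "i \<in> B \<longleftrightarrow> i \<in> C" if "i < n" for i
    using equal_share_index[OF B that, of k] equal_share_index[OF C that, of k] eq assms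
    by (auto simp: of_bool_def split: if_splits)
  thus "B = C" using B C by (auto simp: subset_iff)
qed

lemma equal_shares_eq_image: "equal_shares n k = equal_share n k ` {B. B \<subseteq> {0..<n} \<and> card B = k}"
  by (auto simp: equal_shares_def equal_share_def)

lemma card_equal_shares:
  assumes "1 \<le> k"
  shows "card (equal_shares n k) = n choose k"
  unfolding equal_shares_eq_image card_image[OF equal_share_inj[OF assms]]
  by (subst n_subsets) auto

lemma equal_shares_carrier: "\<alpha> \<in> equal_shares n k \<Longrightarrow> \<alpha> \<in> carrier_vec n"
  by (auto simp: equal_shares_eq_image)

lemma sum_equal_shares:
  fixes f :: "real vec \<Rightarrow> real"
  assumes "1 \<le> k"
  shows "(\<Sum>\<alpha>\<in>equal_shares n k. f \<alpha>) =
    (\<Sum>B | B \<subseteq> {0..<n} \<and> card B = k. f (equal_share n k B))"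
  unfolding equal_shares_eq_image by (subst sum.reindex[OF equal_share_inj[OF assms]]) simp

text \<open>The value does not depend on \<open>i\<close>: the average share vector is a multiple of
  the all-ones vector.\<close>

lemma sum_equal_shares_index:
  assumes k: "1 \<le> k" and i: "i < n"
  shows "(\<Sum>\<alpha>\<in>equal_shares n k. \<alpha> $ i) = real (n choose k) / n"
proof -
  have "(\<Sum>\<alpha>\<in>equal_shares n k. \<alpha> $ i) =
      (\<Sum>B | B \<subseteq> {0..<n} \<and> card B = k. of_bool (i \<in> B)) / real k"
    unfolding sum_equal_shares[OF k] sum_divide_distrib
    using i by (intro sum.cong) (auto simp: equal_share_index)
  also have "\<dots> = real (card {B. B \<subseteq> {0..<n} \<and> card B = k \<and> i \<in> B}) / k"
    by (simp add: sum_of_bool_eq Collect_conj_eq Int_ac)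
  also have "real (card {B. B \<subseteq> {0..<n} \<and> card B = k \<and> i \<in> B}) = real k * (n choose k) / n"
    using card_subsets_containing[OF k i] i by (simp add: eq_divide_eq mult.commute)
  finally show ?thesis using k by simp
qed

text \<open>The product is \<open>1 / k^2\<close> exactly when both nodes lie in \<open>B\<close>.
  For \<open>k \<le> n\<close>, the factor \<open>(k - 1) / (n - 1)\<close> is the probability that
  a random \<open>k\<close>-subset containing \<open>i\<close> also contains
  \<open>j\<close>.\<close>

lemma sum_equal_shares_index_mult:
  assumes k: "1 \<le> k" and n: "2 \<le> n" and ij: "i < n" "j < n"
  shows "(\<Sum>\<alpha>\<in>equal_shares n k. \<alpha> $ i * \<alpha> $ j) =
    real (n choose k) / (real k * n) * (if i = j then 1 else (real k - 1) / (real n - 1))"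
proof -
  have "(\<Sum>\<alpha>\<in>equal_shares n k. \<alpha> $ i * \<alpha> $ j) =
      (\<Sum>B | B \<subseteq> {0..<n} \<and> card B = k. of_bool (i \<in> B \<and> j \<in> B)) / (real k * real k)"
    unfolding sum_equal_shares[OF k] sum_divide_distrib
    using ij by (intro sum.cong) (auto simp: equal_share_index)
  also have "\<dots> = real (card {B. B \<subseteq> {0..<n} \<and> card B = k \<and> i \<in> B \<and> j \<in> B}) / (real k * real k)"
    by (simp add: sum_of_bool_eq Collect_conj_eq Int_ac)
  finally have *: "(\<Sum>\<alpha>\<in>equal_shares n k. \<alpha> $ i * \<alpha> $ j) = \<dots>" .
  show ?thesis
  proof (cases "i = j")
    case True
    have "real (card {B. B \<subseteq> {0..<n} \<and> card B = k \<and> i \<in> B}) = real k * (n choose k) / n"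
      using card_subsets_containing[OF k ij(1)] n by (simp add: eq_divide_eq mult.commute)
    thus ?thesis using True k unfolding * by simp
  next
    case False
    have "real n * (real n - 1) \<noteq> 0" using n by simp
    hence "real (card {B. B \<subseteq> {0..<n} \<and> card B = k \<and> i \<in> B \<and> j \<in> B})
        = real k * (real k - 1) * (n choose k) / (real n * (real n - 1))"
      using card_subsets_containing_pair[OF k ij False] by (simp add: eq_divide_eq mult.commute)
    thus ?thesis using False k unfolding * by (simp add: mult_ac)
  qed
qed

text \<open>The second moments form a combination of the all-ones matrix and the identity. Zero row
  sums cancel the first part, and the second part leaves the trace.\<close>

lemma sum_equal_shares_quadratic_form:
  fixes P :: "nat \<Rightarrow> nat \<Rightarrow> real"
  assumes k: "1 \<le> k" and n: "2 \<le> n" and row: "\<And>i. i < n \<Longrightarrow> (\<Sum>j\<in>{0..<n}. P i j) = 0"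
  shows "(\<Sum>\<alpha>\<in>equal_shares n k. \<Sum>i\<in>{0..<n}. \<Sum>j\<in>{0..<n}. P i j * (\<alpha> $ i * \<alpha> $ j)) =
    real (n choose k) * ((real n - k) / (real k * n * (real n - 1))) * (\<Sum>i\<in>{0..<n}. P i i)"
proof -
  define c d where "c = real (n choose k) / (real k * n)" and "d = (real k - 1) / (real n - 1)"
  have "(\<Sum>\<alpha>\<in>equal_shares n k. \<Sum>i\<in>{0..<n}. \<Sum>j\<in>{0..<n}. P i j * (\<alpha> $ i * \<alpha> $ j)) =
      (\<Sum>i\<in>{0..<n}. \<Sum>j\<in>{0..<n}. P i j * (\<Sum>\<alpha>\<in>equal_shares n k. \<alpha> $ i * \<alpha> $ j))"
    by (subst sum.swap, rule sum.cong[OF refl], subst sum.swap) (simp add: sum_distrib_left)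
  also have "\<dots> = (\<Sum>i\<in>{0..<n}. \<Sum>j\<in>{0..<n}. c * d * P i j + (if i = j then c * (1 - d) * P i j else 0))"
    using sum_equal_shares_index_mult[OF k n]
    by (intro sum.cong refl) (auto simp: c_def d_def algebra_simps)
  also have "\<dots> = (\<Sum>i\<in>{0..<n}. c * (1 - d) * P i i)"
    by (intro sum.cong refl) (simp add: sum.distrib row flip: sum_distrib_left)
  also have "\<dots> = c * (1 - d) * (\<Sum>i\<in>{0..<n}. P i i)"
    by (simp add: sum_distrib_left)
  also have "c * (1 - d) = real (n choose k) * ((real n - k) / (real k * n * (real n - 1)))"
    using n k by (simp add: c_def d_def divide_simps)
  finally show ?thesis .
qed

section \<open>Expected losses\<close>

text \<open>As \<open>\<mu>\<close> is balanced, the imbalance to be shared out according to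
  \<open>\<alpha>\<close> comes from the fluctuations alone.\<close>

lemma net_injection_index:
  assumes dims: "\<mu> \<in> carrier_vec n" "w \<in> carrier_vec n" "\<alpha> \<in> carrier_vec n"
    and bal: "ones n \<bullet> \<mu> = 0" and i: "i < n"
  shows "net_injection n \<mu> w \<alpha> $ i = \<mu> $ i + w $ i - \<alpha> $ i * (\<Sum>j\<in>{0..<n}. w $ j)"
proof -
  have mu: "(\<Sum>j\<in>{0..<n}. \<mu> $ j) = 0"
    using bal dims by (simp add: scalar_prod_def ones_def)
  have "net_injection n \<mu> w \<alpha> $ i =
      (\<Sum>j\<in>{0..<n}. ((if i = j then 1 else 0) - \<alpha> $ i) * (\<mu> $ j + w $ j))"
    using dims i unfolding net_injection_def control_mat_def outer_def ones_def
    by (simp add: scalar_prod_def)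
  also have "\<dots> = (\<Sum>j\<in>{0..<n}. (if i = j then \<mu> $ j + w $ j else 0)
      - \<alpha> $ i * \<mu> $ j - \<alpha> $ i * w $ j)"
    by (intro sum.cong) (auto simp: algebra_simps)
  also have "\<dots> = \<mu> $ i + w $ i - \<alpha> $ i * (\<Sum>j\<in>{0..<n}. w $ j)"
    using i mu by (simp add: sum_subtractf flip: sum_distrib_left)
  finally show ?thesis .
qed

lemma net_injection_carrier: "\<alpha> \<in> carrier_vec n \<Longrightarrow> net_injection n \<mu> w \<alpha> \<in> carrier_vec n"
  by (simp add: net_injection_def control_mat_def outer_def ones_def mult_mat_vec_def)

text \<open>Of the nine products in the expanded quadratic form, the one in \<open>\<mu>\<close>
  alone is cancelled by the subtracted loss. The others are grouped so that each random factor is a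
  load, the aggregate \<open>s\<close>, or a product of two of these.\<close>

lemma fluct_loss_eq_sum:
  assumes P: "pinv L \<in> carrier_mat n n"
    and dims: "\<mu> \<in> carrier_vec n" "w \<in> carrier_vec n" "\<alpha> \<in> carrier_vec n"
    and bal: "ones n \<bullet> \<mu> = 0"
  defines "s \<equiv> \<Sum>j\<in>{0..<n}. w $ j"
  shows "fluct_loss n L \<mu> w \<alpha> = 1 / 2 * (\<Sum>i\<in>{0..<n}. \<Sum>j\<in>{0..<n}. pinv L $$ (i, j) *
    (\<mu> $ i * w $ j + \<mu> $ j * w $ i + w $ i * w $ j
      - \<mu> $ i * \<alpha> $ j * s - \<alpha> $ i * \<mu> $ j * s
      - \<alpha> $ j * (s * w $ i) - \<alpha> $ i * (s * w $ j) + \<alpha> $ i * \<alpha> $ j * (s * s)))"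
proof -
  have "net_injection n \<mu> w \<alpha> $ i = \<mu> $ i + w $ i - \<alpha> $ i * s" if "i < n" for i
    unfolding s_def by (rule net_injection_index[OF dims bal that])
  hence "net_injection n \<mu> w \<alpha> \<bullet> (pinv L *\<^sub>v net_injection n \<mu> w \<alpha>) - \<mu> \<bullet> (pinv L *\<^sub>v \<mu>) =
      (\<Sum>i\<in>{0..<n}. \<Sum>j\<in>{0..<n}. pinv L $$ (i, j) *
         ((\<mu> $ i + w $ i - \<alpha> $ i * s) * (\<mu> $ j + w $ j - \<alpha> $ j * s)) - pinv L $$ (i, j) * (\<mu> $ i * \<mu> $ j))"
    by (simp add: scalar_prod_mult_mat_vec_eq_sum[OF P] net_injection_carrier dims sum_subtractf)
  also have "\<dots> = (\<Sum>i\<in>{0..<n}. \<Sum>j\<in>{0..<n}. pinv L $$ (i, j) *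
    (\<mu> $ i * w $ j + \<mu> $ j * w $ i + w $ i * w $ j
      - \<mu> $ i * \<alpha> $ j * s - \<alpha> $ i * \<mu> $ j * s
      - \<alpha> $ j * (s * w $ i) - \<alpha> $ i * (s * w $ j) + \<alpha> $ i * \<alpha> $ j * (s * s)))"
    by (intro sum.cong refl) (simp add: algebra_simps)
  finally show ?thesis by (simp add: fluct_loss_def total_loss_def field_simps)
qed

text \<open>The randomness of a single network; it is interpreted separately for each
  \<open>n\<close> when passing to the limit.\<close>

locale load_fluctuations = prob_space M for M :: "'a measure" +
  fixes n :: nat and \<omega> :: "'a \<Rightarrow> real vec"
  assumes dim: "\<And>x. x \<in> space M \<Longrightarrow> \<omega> x \<in> carrier_vec n"
    and meas: "\<And>i. i < n \<Longrightarrow> (\<lambda>x. \<omega> x $ i) \<in> borel_measurable M"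
    and second_moment: "\<And>i. i < n \<Longrightarrow> integrable M (\<lambda>x. (\<omega> x $ i)\<^sup>2)"
    and mean: "\<And>i. i < n \<Longrightarrow> (\<integral>x. \<omega> x $ i \<partial>M) = 0"
begin

section \<open>First and second moments of the loads and of their aggregate\<close>

lemma integrable_component: "i < n \<Longrightarrow> integrable M (\<lambda>x. \<omega> x $ i)"
  using square_integrable_imp_integrable[OF meas second_moment] .

lemma integrable_component_mult:
  assumes "i < n" "j < n"
  shows "integrable M (\<lambda>x. \<omega> x $ i * \<omega> x $ j)"
proof (rule Bochner_Integration.integrable_bound)
  show "integrable M (\<lambda>x. (\<omega> x $ i)\<^sup>2 + (\<omega> x $ j)\<^sup>2)"
    using assms second_moment by auto
  show "(\<lambda>x. \<omega> x $ i * \<omega> x $ j) \<in> borel_measurable M"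
    using assms meas by auto
  have "\<bar>a * b\<bar> \<le> a\<^sup>2 + b\<^sup>2" for a b :: real
  proof -
    have "2 * \<bar>a\<bar> * \<bar>b\<bar> \<le> a\<^sup>2 + b\<^sup>2"
      using sum_squares_bound[of "\<bar>a\<bar>" "\<bar>b\<bar>"] by simp
    moreover have "0 \<le> \<bar>a\<bar> * \<bar>b\<bar>" by simp
    ultimately show ?thesis unfolding abs_mult by linarith
  qed
  thus "AE x in M. norm (\<omega> x $ i * \<omega> x $ j) \<le> norm ((\<omega> x $ i)\<^sup>2 + (\<omega> x $ j)\<^sup>2)"
    by auto
qed

abbreviation cov :: "nat \<Rightarrow> nat \<Rightarrow> real" where
  "cov i j \<equiv> cov_mat n M \<omega> $$ (i, j)"

text \<open>Here and below \<open>has_bochner_integral\<close> carries integrability along with the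
  value, so that linear combinations can be integrated term by term.\<close>

lemma has_integral_component: "i < n \<Longrightarrow> has_bochner_integral M (\<lambda>x. \<omega> x $ i) 0"
  using integrable_component mean by (simp add: has_bochner_integral_iff)

lemma has_integral_component_mult:
  "i < n \<Longrightarrow> j < n \<Longrightarrow> has_bochner_integral M (\<lambda>x. \<omega> x $ i * \<omega> x $ j) (cov i j)"
  using integrable_component_mult by (simp add: has_bochner_integral_iff cov_mat_def)

lemma has_integral_aggregate: "has_bochner_integral M (\<lambda>x. \<Sum>l\<in>{0..<n}. \<omega> x $ l) 0"
  using has_bochner_integral_sum[of "{0..<n}" M "\<lambda>l x. \<omega> x $ l" "\<lambda>_. 0"] has_integral_component
  by simp

lemma has_integral_aggregate_component:
  "i < n \<Longrightarrow> has_bochner_integral M (\<lambda>x. (\<Sum>l\<in>{0..<n}. \<omega> x $ l) * \<omega> x $ i) (\<Sum>l\<in>{0..<n}. cov l i)"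
  unfolding sum_distrib_right
  by (intro has_bochner_integral_sum has_integral_component_mult) auto

text \<open>This identifies \<open>aggregate_var\<close> as the variance of the total fluctuation,
  whose mean is zero.\<close>

lemma has_integral_aggregate_square:
  "has_bochner_integral M (\<lambda>x. (\<Sum>l\<in>{0..<n}. \<omega> x $ l) * (\<Sum>l\<in>{0..<n}. \<omega> x $ l))
    (aggregate_var n (cov_mat n M \<omega>))"
proof -
  have "aggregate_var n (cov_mat n M \<omega>) = (\<Sum>l\<in>{0..<n}. \<Sum>m\<in>{0..<n}. cov l m)"
    unfolding aggregate_var_def
    by (subst scalar_prod_mult_mat_vec_eq_sum[of _ n]) (auto simp: cov_mat_def ones_def)
  thus ?thesis unfolding sum_product
    by (auto intro!: has_bochner_integral_sum has_integral_component_mult)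
qed

section \<open>Expected loss for a given share vector and its average\<close>

lemma expectation_fluct_loss:
  assumes P: "pinv L \<in> carrier_mat n n" and mu: "\<mu> \<in> carrier_vec n" "ones n \<bullet> \<mu> = 0"
    and \<alpha>: "\<alpha> \<in> carrier_vec n"
  defines "c \<equiv> \<lambda>i. \<Sum>l\<in>{0..<n}. cov l i"
  shows "(\<integral>x. fluct_loss n L \<mu> (\<omega> x) \<alpha> \<partial>M) =
    1 / 2 * (\<Sum>i\<in>{0..<n}. \<Sum>j\<in>{0..<n}. pinv L $$ (i, j) *
      (cov i j - \<alpha> $ j * c i - \<alpha> $ i * c j + \<alpha> $ i * \<alpha> $ j * aggregate_var n (cov_mat n M \<omega>)))"
proof -
  define s where "s x = (\<Sum>l\<in>{0..<n}. \<omega> x $ l)" for x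
  have "has_bochner_integral M (\<lambda>x. s x * \<omega> x $ i) (c i)" if "i < n" for i
    using has_integral_aggregate_component[OF that] by (simp add: s_def c_def)
  note s = this has_integral_aggregate[folded s_def] has_integral_aggregate_square[folded s_def]
  \<comment> \<open>The zeros in the value are the means of the loads and of the aggregate;
    \<open>c i\<close> is the covariance of load \<open>i\<close> with the aggregate. The value
    mirrors the integrand term by term, so that linearity rules alone apply.\<close>
  have "has_bochner_integral M (\<lambda>x. 1 / 2 * (\<Sum>i\<in>{0..<n}. \<Sum>j\<in>{0..<n}. pinv L $$ (i, j) *
    (\<mu> $ i * \<omega> x $ j + \<mu> $ j * \<omega> x $ i + \<omega> x $ i * \<omega> x $ j
      - \<mu> $ i * \<alpha> $ j * s x - \<alpha> $ i * \<mu> $ j * s x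
      - \<alpha> $ j * (s x * \<omega> x $ i) - \<alpha> $ i * (s x * \<omega> x $ j) + \<alpha> $ i * \<alpha> $ j * (s x * s x))))
    (1 / 2 * (\<Sum>i\<in>{0..<n}. \<Sum>j\<in>{0..<n}. pinv L $$ (i, j) *
      (\<mu> $ i * 0 + \<mu> $ j * 0 + cov i j - \<mu> $ i * \<alpha> $ j * 0 - \<alpha> $ i * \<mu> $ j * 0
        - \<alpha> $ j * c i - \<alpha> $ i * c j + \<alpha> $ i * \<alpha> $ j * aggregate_var n (cov_mat n M \<omega>))))"
    by (intro has_bochner_integral_sum has_bochner_integral_add has_bochner_integral_diff
        has_bochner_integral_mult_right s has_integral_component has_integral_component_mult) auto
  moreover have "(\<integral>x. fluct_loss n L \<mu> (\<omega> x) \<alpha> \<partial>M) = (\<integral>x. 1 / 2 * (\<Sum>i\<in>{0..<n}. \<Sum>j\<in>{0..<n}. pinv L $$ (i, j) *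
    (\<mu> $ i * \<omega> x $ j + \<mu> $ j * \<omega> x $ i + \<omega> x $ i * \<omega> x $ j
      - \<mu> $ i * \<alpha> $ j * s x - \<alpha> $ i * \<mu> $ j * s x
      - \<alpha> $ j * (s x * \<omega> x $ i) - \<alpha> $ i * (s x * \<omega> x $ j) + \<alpha> $ i * \<alpha> $ j * (s x * s x))) \<partial>M)"
    unfolding s_def
    by (intro Bochner_Integration.integral_cong refl fluct_loss_eq_sum[OF P mu(1) dim \<alpha> mu(2)])
  ultimately show ?thesis by (simp add: has_bochner_integral_iff)
qed

text \<open>The term free of \<open>\<alpha>\<close> gives \<open>tr (S * P)\<close>, the terms
  linear in \<open>\<alpha>\<close> average to zero, and the quadratic one is evaluated by counting
  subsets. The last fraction is \<open>1 / n\<close> for \<open>k = 1\<close> and 0 for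
  \<open>k = n\<close>.\<close>

lemma avg_fluct_loss_eq:
  assumes G: "weighted_graph n \<beta>" "connected_graph n \<beta>"
    and mu: "\<mu> \<in> carrier_vec n" "ones n \<bullet> \<mu> = 0"
    and k: "1 \<le> k" "k \<le> n" and n: "2 \<le> n"
  defines "P \<equiv> pinv (laplacian n \<beta>)" and "S \<equiv> cov_mat n M \<omega>"
  shows "avg_fluct_loss n (laplacian n \<beta>) \<mu> M \<omega> k =
    1 / 2 * (tr (S * P) + aggregate_var n S * tr P * ((real n - k) / (real k * n * (real n - 1))))"
proof -
  define c where "c i = (\<Sum>l\<in>{0..<n}. S $$ (l, i))" for i
  define N where "N = real (n choose k)"
  define A where "A = equal_shares n k"
  \<comment> \<open>Because \<open>k \<le> n\<close>, there is a \<open>k\<close>-subset, so the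
    average divides by a nonzero number.\<close>
  have N: "N > 0" using k by (simp add: N_def)
  have P: "P \<in> carrier_mat n n" unfolding P_def by (rule pinv_laplacian_carrier[OF G])
  have S: "S \<in> carrier_mat n n" by (simp add: S_def cov_mat_def)
  have row: "(\<Sum>j\<in>{0..<n}. P $$ (i, j)) = 0" if "i < n" for i
    unfolding P_def by (rule pinv_laplacian_row_sum[OF G that])
  have col: "(\<Sum>i\<in>{0..<n}. P $$ (i, j)) = 0" if "j < n" for j
    unfolding P_def by (rule pinv_laplacian_col_sum[OF G that])
  \<comment> \<open>The entrywise pairing of \<open>P\<close> and \<open>S\<close> is a trace
    because the covariance matrix is symmetric.\<close>
  have tr: "(\<Sum>i\<in>{0..<n}. \<Sum>j\<in>{0..<n}. P $$ (i, j) * S $$ (i, j)) = tr (S * P)"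
  proof -
    have "S $$ (i, j) = S $$ (j, i)" if "i < n" "j < n" for i j
      using that by (simp add: S_def cov_mat_def mult.commute)
    thus ?thesis unfolding tr_mult_eq_sum[OF S P]
      by (subst sum.swap) (auto simp: mult.commute intro!: sum.cong)
  qed
  have trP: "tr P = (\<Sum>i\<in>{0..<n}. P $$ (i, i))"
    using P by (simp add: tr_def lessThan_atLeast0)
  \<comment> \<open>Summed over \<open>A\<close>, the factor \<open>\<alpha> $ j\<close> becomes a
    constant, which leaves the row sums of \<open>P\<close>; the mirrored term below leaves the
    column sums.\<close>
  have right: "(\<Sum>\<alpha>\<in>A. \<Sum>i\<in>{0..<n}. \<Sum>j\<in>{0..<n}. P $$ (i, j) * (\<alpha> $ j * c i)) = 0"
  proof -
    have "(\<Sum>\<alpha>\<in>A. \<Sum>i\<in>{0..<n}. \<Sum>j\<in>{0..<n}. P $$ (i, j) * (\<alpha> $ j * c i)) =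
        (\<Sum>i\<in>{0..<n}. \<Sum>j\<in>{0..<n}. P $$ (i, j) * ((\<Sum>\<alpha>\<in>A. \<alpha> $ j) * c i))"
      by (subst sum.swap, rule sum.cong[OF refl], subst sum.swap)
         (simp add: sum_distrib_left sum_distrib_right)
    also have "\<dots> = (\<Sum>i\<in>{0..<n}. \<Sum>j\<in>{0..<n}. P $$ (i, j) * (N / n * c i))"
      using sum_equal_shares_index[OF k(1)] by (intro sum.cong refl) (simp add: A_def N_def)
    also have "\<dots> = (\<Sum>i\<in>{0..<n}. (\<Sum>j\<in>{0..<n}. P $$ (i, j)) * (N / n * c i))"
      by (simp only: sum_distrib_right)
    also have "\<dots> = 0"
      by (simp add: row)
    finally show ?thesis .
  qed
  have left: "(\<Sum>\<alpha>\<in>A. \<Sum>i\<in>{0..<n}. \<Sum>j\<in>{0..<n}. P $$ (i, j) * (\<alpha> $ i * c j)) = 0"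
  proof -
    have "(\<Sum>\<alpha>\<in>A. \<Sum>i\<in>{0..<n}. \<Sum>j\<in>{0..<n}. P $$ (i, j) * (\<alpha> $ i * c j)) =
        (\<Sum>i\<in>{0..<n}. \<Sum>j\<in>{0..<n}. P $$ (i, j) * ((\<Sum>\<alpha>\<in>A. \<alpha> $ i) * c j))"
      by (subst sum.swap, rule sum.cong[OF refl], subst sum.swap)
         (simp add: sum_distrib_left sum_distrib_right)
    also have "\<dots> = (\<Sum>i\<in>{0..<n}. \<Sum>j\<in>{0..<n}. P $$ (i, j) * (N / n * c j))"
      using sum_equal_shares_index[OF k(1)] by (intro sum.cong refl) (simp add: A_def N_def)
    also have "\<dots> = (\<Sum>j\<in>{0..<n}. (\<Sum>i\<in>{0..<n}. P $$ (i, j)) * (N / n * c j))"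
      by (subst sum.swap) (simp only: sum_distrib_right)
    also have "\<dots> = 0"
      by (simp add: col)
    finally show ?thesis .
  qed
  have quad: "(\<Sum>\<alpha>\<in>A. \<Sum>i\<in>{0..<n}. \<Sum>j\<in>{0..<n}. P $$ (i, j) * (\<alpha> $ i * \<alpha> $ j)) =
      N * ((real n - k) / (real k * n * (real n - 1))) * tr P"
    unfolding A_def N_def trP
    by (rule sum_equal_shares_quadratic_form[OF k(1) n]) (rule row)
  have "(\<Sum>\<alpha>\<in>A. \<integral>x. fluct_loss n (laplacian n \<beta>) \<mu> (\<omega> x) \<alpha> \<partial>M) =
      (\<Sum>\<alpha>\<in>A. 1 / 2 * ((\<Sum>i\<in>{0..<n}. \<Sum>j\<in>{0..<n}. P $$ (i, j) * S $$ (i, j))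
        - (\<Sum>i\<in>{0..<n}. \<Sum>j\<in>{0..<n}. P $$ (i, j) * (\<alpha> $ j * c i))
        - (\<Sum>i\<in>{0..<n}. \<Sum>j\<in>{0..<n}. P $$ (i, j) * (\<alpha> $ i * c j))
        + aggregate_var n S * (\<Sum>i\<in>{0..<n}. \<Sum>j\<in>{0..<n}. P $$ (i, j) * (\<alpha> $ i * \<alpha> $ j))))"
  proof (rule sum.cong[OF refl])
    fix \<alpha> assume "\<alpha> \<in> A"
    hence \<alpha>: "\<alpha> \<in> carrier_vec n" using equal_shares_carrier by (simp add: A_def)
    show "(\<integral>x. fluct_loss n (laplacian n \<beta>) \<mu> (\<omega> x) \<alpha> \<partial>M) =
      1 / 2 * ((\<Sum>i\<in>{0..<n}. \<Sum>j\<in>{0..<n}. P $$ (i, j) * S $$ (i, j))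
        - (\<Sum>i\<in>{0..<n}. \<Sum>j\<in>{0..<n}. P $$ (i, j) * (\<alpha> $ j * c i))
        - (\<Sum>i\<in>{0..<n}. \<Sum>j\<in>{0..<n}. P $$ (i, j) * (\<alpha> $ i * c j))
        + aggregate_var n S * (\<Sum>i\<in>{0..<n}. \<Sum>j\<in>{0..<n}. P $$ (i, j) * (\<alpha> $ i * \<alpha> $ j)))"
      unfolding expectation_fluct_loss[OF P[unfolded P_def] mu \<alpha>] P_def[symmetric]
        S_def[symmetric] c_def[symmetric]
      by (simp add: ring_distribs sum.distrib sum_subtractf sum_distrib_left mult_ac)
  qed
  also have "\<dots> = 1 / 2 * (card A * tr (S * P)
      + aggregate_var n S * (N * ((real n - k) / (real k * n * (real n - 1))) * tr P))"
    using left right quad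
    by (simp add: tr sum.distrib sum_subtractf flip: sum_distrib_left sum_divide_distrib)
  also have "card A = N" by (simp add: A_def N_def card_equal_shares[OF k(1)])
  finally show ?thesis
    using N \<open>real (card A) = N\<close> unfolding avg_fluct_loss_def A_def[symmetric]
    by (simp add: field_simps)
qed

text \<open>Both losses contain the nonzero factor \<open>f\<close>, half of
  \<open>a * t / (n - 1)\<close>, which cancels. What remains depends on the network only through
  \<open>g\<close> and \<open>n\<close>.\<close>

lemma fluct_loss_ratio:
  assumes G: "weighted_graph n \<beta>" "connected_graph n \<beta>"
    and mu: "\<mu> \<in> carrier_vec n" "ones n \<bullet> \<mu> = 0"
    and k: "1 \<le> k" "k \<le> n" and n: "2 \<le> n"
    and pos: "0 < aggregate_var n (cov_mat n M \<omega>)"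
  defines "g \<equiv> gamma_ratio n (laplacian n \<beta>) (cov_mat n M \<omega>)"
  shows "avg_fluct_loss n (laplacian n \<beta>) \<mu> M \<omega> k / avg_fluct_loss n (laplacian n \<beta>) \<mu> M \<omega> 1 =
    (g + (real n - k) / n / k) / (g + (real n - 1) / n)"
proof -
  define a t where "a = aggregate_var n (cov_mat n M \<omega>)" and "t = tr (pinv (laplacian n \<beta>))"
  define f where "f = a * t / (real n - 1) / 2"
  have nz: "a \<noteq> 0" "t \<noteq> 0" "real n - 1 \<noteq> 0"
    using pos tr_pinv_laplacian_neq_0[OF G n] n by (auto simp: a_def t_def)
  hence "f \<noteq> 0" by (simp add: f_def)
  have T: "tr (cov_mat n M \<omega> * pinv (laplacian n \<beta>)) = g * (2 * f)"
    using nz(1,2) n unfolding g_def gamma_ratio_def f_def a_def[symmetric] t_def[symmetric]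
    by (simp add: divide_simps)
  have "avg_fluct_loss n (laplacian n \<beta>) \<mu> M \<omega> m = f * (g + (real n - m) / n / m)"
    if "1 \<le> m" "m \<le> n" for m
  proof -
    have "a * t * ((real n - m) / (real m * n * (real n - 1))) = 2 * f * ((real n - m) / n / m)"
      by (simp add: f_def mult_ac del: distrib_left_numeral right_diff_distrib_numeral)
    thus ?thesis
      unfolding avg_fluct_loss_eq[OF G mu that n] T a_def[symmetric] t_def[symmetric]
      by (simp add: algebra_simps)
  qed
  from this[OF k] this[of 1] \<open>f \<noteq> 0\<close> n show ?thesis by simp
qed

text \<open>The covariance matrix is \<open>v\<close> times the identity, so the numerator contains
  \<open>v * tr P\<close> and the denominator \<open>n * v * tr P\<close>; the graph cancels.
  Positive aggregate variance ensures \<open>v \<noteq> 0\<close>.\<close>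

lemma gamma_ratio_iid:
  assumes G: "weighted_graph n \<beta>" "connected_graph n \<beta>" and n: "2 \<le> n"
    and indep: "indep_vars (\<lambda>_. borel) (\<lambda>i x. \<omega> x $ i) {0..<n}"
    and ident: "\<And>i j. i < n \<Longrightarrow> j < n \<Longrightarrow>
      distr M borel (\<lambda>x. \<omega> x $ i) = distr M borel (\<lambda>x. \<omega> x $ j)"
    and pos: "0 < aggregate_var n (cov_mat n M \<omega>)"
  shows "gamma_ratio n (laplacian n \<beta>) (cov_mat n M \<omega>) = (real n - 1) / n"
proof -
  define v where "v = cov 0 0"
  define P where "P = pinv (laplacian n \<beta>)"
  have P: "P \<in> carrier_mat n n" unfolding P_def by (rule pinv_laplacian_carrier[OF G])
  have S: "cov_mat n M \<omega> \<in> carrier_mat n n" by (simp add: cov_mat_def)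
  have diag: "cov i i = v" if i: "i < n" for i
  proof -
    \<comment> \<open>Written as an integral against the law of the load, the variance is seen to
      depend on that law alone.\<close>
    have sq: "cov j j = (\<integral>y. y * y \<partial>distr M borel (\<lambda>x. \<omega> x $ j))" if "j < n" for j
      using that meas[OF that] by (subst integral_distr) (auto simp: cov_mat_def)
    show ?thesis using sq[OF i] sq[of 0] ident[of i 0] i by (simp add: v_def)
  qed
  have off: "cov i j = 0" if ij: "i < n" "j < n" "i \<noteq> j" for i j
  proof -
    \<comment> \<open>The product rule for independent families, applied to the two-element
      subfamily; both factors have mean zero.\<close>
    have "(\<integral>x. (\<Prod>l\<in>{i, j}. \<omega> x $ l) \<partial>M) = (\<Prod>l\<in>{i, j}. \<integral>x. \<omega> x $ l \<partial>M)"
      using ij integrable_component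
      by (intro indep_vars_lebesgue_integral indep_vars_subset[OF indep]) auto
    thus ?thesis using ij mean by (simp add: cov_mat_def)
  qed
  have cov: "cov i j = (if i = j then v else 0)" if "i < n" "j < n" for i j
    using diag off that by simp
  have "tr (cov_mat n M \<omega> * P) = (\<Sum>i\<in>{0..<n}. \<Sum>j\<in>{0..<n}. if i = j then v * P $$ (j, i) else 0)"
    unfolding tr_mult_eq_sum[OF S P] by (intro sum.cong refl) (simp add: cov)
  also have "\<dots> = v * tr P"
    using P by (simp add: tr_def lessThan_atLeast0 sum_distrib_left)
  finally have T: "tr (cov_mat n M \<omega> * P) = v * tr P" .
  have "aggregate_var n (cov_mat n M \<omega>) = (\<Sum>i\<in>{0..<n}. \<Sum>j\<in>{0..<n}. cov i j)"
    unfolding aggregate_var_def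
    by (subst scalar_prod_mult_mat_vec_eq_sum[OF S]) (auto simp: ones_def)
  also have "\<dots> = (\<Sum>i\<in>{0..<n}. \<Sum>j\<in>{0..<n}. if i = j then v else 0)"
    by (intro sum.cong refl) (simp add: cov)
  also have "\<dots> = n * v" by simp
  finally have a: "aggregate_var n (cov_mat n M \<omega>) = n * v" .
  have "v \<noteq> 0" using pos a by auto
  moreover have "tr P \<noteq> 0" unfolding P_def by (rule tr_pinv_laplacian_neq_0[OF G n])
  ultimately show ?thesis
    by (simp add: gamma_ratio_def a T flip: P_def)
qed

end

section \<open>Passage to the limit\<close>

lemma tendsto_diff_over_n: "(\<lambda>n. (real n - c) / real n) \<longlonglongrightarrow> 1"
proof (rule Lim_transform_eventually)
  show "(\<lambda>n. 1 - c / real n) \<longlonglongrightarrow> 1"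
    using tendsto_diff[OF tendsto_const lim_const_over_n[of c], of 1] by simp
  show "\<forall>\<^sub>F n in sequentially. 1 - c / real n = (real n - c) / real n"
    using eventually_gt_at_top[of 0] by eventually_elim (simp add: diff_divide_distrib)
qed

theorem mainTheorem4:
  fixes \<beta> :: "nat \<Rightarrow> nat \<Rightarrow> nat \<Rightarrow> real"
    and \<mu> :: "nat \<Rightarrow> real vec"
    and M :: "nat \<Rightarrow> 'a measure"
    and \<omega> :: "nat \<Rightarrow> 'a \<Rightarrow> real vec"
  assumes graph: "\<And>n. 2 \<le> n \<Longrightarrow> weighted_graph n (\<beta> n)"
    and connected: "\<And>n. 2 \<le> n \<Longrightarrow> connected_graph n (\<beta> n)"
    and mu_dim: "\<And>n. 2 \<le> n \<Longrightarrow> \<mu> n \<in> carrier_vec n"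
    and mu_balanced: "\<And>n. 2 \<le> n \<Longrightarrow> ones n \<bullet> \<mu> n = 0"
    and prob: "\<And>n. 2 \<le> n \<Longrightarrow> prob_space (M n)"
    and omega_dim: "\<And>n x. 2 \<le> n \<Longrightarrow> x \<in> space (M n) \<Longrightarrow> \<omega> n x \<in> carrier_vec n"
    and omega_measurable: "\<And>n i. 2 \<le> n \<Longrightarrow> i < n \<Longrightarrow> (\<lambda>x. \<omega> n x $ i) \<in> borel_measurable (M n)"
    and omega_second_moment: "\<And>n i. 2 \<le> n \<Longrightarrow> i < n \<Longrightarrow> integrable (M n) (\<lambda>x. (\<omega> n x $ i)\<^sup>2)"
    and omega_mean: "\<And>n i. 2 \<le> n \<Longrightarrow> i < n \<Longrightarrow> (\<integral>x. \<omega> n x $ i \<partial>M n) = 0"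
    and sigma_pos: "\<And>n. 2 \<le> n \<Longrightarrow> 0 < aggregate_var n (cov_mat n (M n) (\<omega> n))"
  shows
    "(\<forall>\<gamma>\<ge>0.
        (\<lambda>n. gamma_ratio n (laplacian n (\<beta> n)) (cov_mat n (M n) (\<omega> n))) \<longlonglongrightarrow> \<gamma> \<longrightarrow>
        (\<forall>k\<ge>1.
          (\<lambda>n. avg_fluct_loss n (laplacian n (\<beta> n)) (\<mu> n) (M n) (\<omega> n) k /
               avg_fluct_loss n (laplacian n (\<beta> n)) (\<mu> n) (M n) (\<omega> n) 1)
          \<longlonglongrightarrow> (if \<gamma> = 0 then 0 else 1 / (1 + inverse \<gamma>)) + 1 / (1 + \<gamma>) * (1 / real k)))
     \<and>
     ((\<forall>n\<ge>2.
         prob_space.indep_vars (M n) (\<lambda>_. borel) (\<lambda>i x. \<omega> n x $ i) {0..<n} \<and>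
         (\<forall>i<n. \<forall>j<n. distr (M n) borel (\<lambda>x. \<omega> n x $ i) = distr (M n) borel (\<lambda>x. \<omega> n x $ j)))
       \<longrightarrow>
       (\<lambda>n. gamma_ratio n (laplacian n (\<beta> n)) (cov_mat n (M n) (\<omega> n))) \<longlonglongrightarrow> 1 \<and>
       (\<forall>k\<ge>1.
          (\<lambda>n. avg_fluct_loss n (laplacian n (\<beta> n)) (\<mu> n) (M n) (\<omega> n) k /
               avg_fluct_loss n (laplacian n (\<beta> n)) (\<mu> n) (M n) (\<omega> n) 1)
          \<longlonglongrightarrow> 1 / 2 + 1 / (2 * real k)))"
proof -
  let ?g = "\<lambda>n. gamma_ratio n (laplacian n (\<beta> n)) (cov_mat n (M n) (\<omega> n))"
  let ?H = "\<lambda>k n. avg_fluct_loss n (laplacian n (\<beta> n)) (\<mu> n) (M n) (\<omega> n) k"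
  have loads: "load_fluctuations (M n) n (\<omega> n)" if "2 \<le> n" for n
    unfolding load_fluctuations_def load_fluctuations_axioms_def
    using that prob omega_dim omega_measurable omega_second_moment omega_mean by blast
  have limit: "(\<lambda>n. ?H k n / ?H 1 n) \<longlonglongrightarrow>
      (if \<gamma> = 0 then 0 else 1 / (1 + inverse \<gamma>)) + 1 / (1 + \<gamma>) * (1 / real k)"
    if \<gamma>: "0 \<le> \<gamma>" "?g \<longlonglongrightarrow> \<gamma>" and k: "1 \<le> k" for \<gamma> k
  proof (rule Lim_transform_eventually)
    \<comment> \<open>With \<open>k\<close> fixed, \<open>(n - k) / n\<close> and
      \<open>(n - 1) / n\<close> tend to 1, and \<open>\<gamma> + 1\<close> is nonzero because
      \<open>\<gamma>\<close> is nonnegative.\<close>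
    have "(\<lambda>n. (?g n + (real n - k) / n / k) / (?g n + (real n - 1) / n))
        \<longlonglongrightarrow> (\<gamma> + 1 / real k) / (\<gamma> + 1)"
      using \<gamma> k by (intro tendsto_intros tendsto_diff_over_n) auto
    also have "(\<gamma> + 1 / real k) / (\<gamma> + 1) =
        (if \<gamma> = 0 then 0 else 1 / (1 + inverse \<gamma>)) + 1 / (1 + \<gamma>) * (1 / real k)"
    proof (cases "\<gamma> = 0")
      \<comment> \<open>The cases are separated because \<open>inverse 0 = 0\<close> would make the
        first summand 1 instead of 0 at \<open>\<gamma> = 0\<close>.\<close>
      case False
      hence "1 / (1 + inverse \<gamma>) = \<gamma> / (\<gamma> + 1)"
        using \<gamma>(1) by (simp add: field_simps)
      thus ?thesis using False by (simp add: add_divide_distrib add.commute mult.commute)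
    qed simp
    finally show "(\<lambda>n. (?g n + (real n - k) / n / k) / (?g n + (real n - 1) / n)) \<longlonglongrightarrow> \<dots>" .
    show "\<forall>\<^sub>F n in sequentially. (?g n + (real n - k) / n / k) / (?g n + (real n - 1) / n)
        = ?H k n / ?H 1 n"
      \<comment> \<open>The closed form of the ratio is available once there are at least two nodes
        and at least \<open>k\<close> of them.\<close>
      using eventually_ge_at_top[of "max 2 k"]
    proof eventually_elim
      case (elim n)
      hence n: "2 \<le> n" "k \<le> n" by auto
      interpret load_fluctuations "M n" n "\<omega> n" by (rule loads[OF n(1)])
      show ?case
        using fluct_loss_ratio[OF graph[OF n(1)] connected[OF n(1)] mu_dim[OF n(1)]
            mu_balanced[OF n(1)] k n(2) n(1) sigma_pos[OF n(1)]] by simp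
    qed
  qed
  have iid: "?g \<longlonglongrightarrow> 1"
    if *: "\<forall>n\<ge>2. prob_space.indep_vars (M n) (\<lambda>_. borel) (\<lambda>i x. \<omega> n x $ i) {0..<n} \<and>
      (\<forall>i<n. \<forall>j<n. distr (M n) borel (\<lambda>x. \<omega> n x $ i) = distr (M n) borel (\<lambda>x. \<omega> n x $ j))"
  \<comment> \<open>For i.i.d. loads the ratio equals \<open>(n - 1) / n\<close> from
    \<open>n = 2\<close> on, whatever the graphs are.\<close>
  proof (rule Lim_transform_eventually[OF tendsto_diff_over_n[of 1]])
    show "\<forall>\<^sub>F n in sequentially. (real n - 1) / real n = ?g n"
      using eventually_ge_at_top[of 2]
    proof eventually_elim
      case (elim n)
      interpret load_fluctuations "M n" n "\<omega> n" by (rule loads[OF elim])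
      have "indep_vars (\<lambda>_. borel) (\<lambda>i x. \<omega> n x $ i) {0..<n}"
        and "\<And>i j. i < n \<Longrightarrow> j < n \<Longrightarrow>
          distr (M n) borel (\<lambda>x. \<omega> n x $ i) = distr (M n) borel (\<lambda>x. \<omega> n x $ j)"
        using * elim by blast+
      from gamma_ratio_iid[OF graph[OF elim] connected[OF elim] elim this sigma_pos[OF elim]]
      show ?case by simp
    qed
  qed
  show ?thesis
  proof (rule conjI)
    show "\<forall>\<gamma>\<ge>0. ?g \<longlonglongrightarrow> \<gamma> \<longrightarrow> (\<forall>k\<ge>1. (\<lambda>n. ?H k n / ?H 1 n) \<longlonglongrightarrow>
        (if \<gamma> = 0 then 0 else 1 / (1 + inverse \<gamma>)) + 1 / (1 + \<gamma>) * (1 / real k))"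
      by (intro allI impI) (rule limit)
    show "(\<forall>n\<ge>2. prob_space.indep_vars (M n) (\<lambda>_. borel) (\<lambda>i x. \<omega> n x $ i) {0..<n} \<and>
        (\<forall>i<n. \<forall>j<n. distr (M n) borel (\<lambda>x. \<omega> n x $ i) = distr (M n) borel (\<lambda>x. \<omega> n x $ j)))
      \<longrightarrow> ?g \<longlonglongrightarrow> 1 \<and> (\<forall>k\<ge>1. (\<lambda>n. ?H k n / ?H 1 n) \<longlonglongrightarrow> 1 / 2 + 1 / (2 * real k))"
      (is "?iid \<longrightarrow> _")
    proof (rule impI)
      assume ?iid
      hence g: "?g \<longlonglongrightarrow> 1" by (rule iid)
      have "(\<lambda>n. ?H k n / ?H 1 n) \<longlonglongrightarrow> 1 / 2 + 1 / (2 * real k)" if "1 \<le> k" for k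
        using limit[OF zero_le_one g that] by simp
      with g show "?g \<longlonglongrightarrow> 1 \<and> (\<forall>k\<ge>1. (\<lambda>n. ?H k n / ?H 1 n) \<longlonglongrightarrow> 1 / 2 + 1 / (2 * real k))"
        by (intro conjI allI impI)
    qed
  qed
qed

end
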